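(* Consider the discrete-time, discrete-space system $$\mathbf{x}(t+1)=\mathbf{f}(\mathbf{x}(t),\mathbf{u}(t),\boldsymbol\theta),\quad \mathbf{x}(0)=\mathbf{x}_0,\qquad \mathbf{y}(t)=\mathbf{g}(\mathbf{x}(t),\boldsymbol\theta),\qquad t\in\mathbb{Z}_{\ge 0},$$ with state space $X$, input space $U$, output space $Y$ and parameter space $\Theta$. Suppose that there are integers $T\ge 1$ and $r\ge 1$, functions $\phi_i:U^T\times Y^{T+1}\to\mathbb{R}$ ($i=0,\dots,r$) and coefficient maps $\alpha_i:\Theta\to\mathbb{R}$ ($i=0,\dots,r$) with $\alpha_0=1$, such that the input-output relation $$\sum_{i=0}^{r}\alpha_i(\boldsymbol\theta)\,\phi_i\big(\langle\mathbf{u}(t)\rangle_0^{T-1},\langle\mathbf{y}(t)\rangle_0^{T}\big)=0$$ is satisfied by the system (that is, for every $\boldsymbol\theta\in\Theta$, every initial state and every input sequence, with $\mathbf{y}$ the corresponding output). For $s=0,\dots,r-1$ put $\phi_i^{s}=\phi_i\big(\langle\mathbf{u}(t)\rangle_s^{T-1+s},\langle\mathbf{y}(t)\rangle_s^{T+s}\big)$ and let $$\mathbf{A}=\begin{bmatrix}\phi_1^{0}&\cdots&\phi_r^{0}\\ \vdots&\ddots&\vdots\\ \phi_1^{r-1}&\cdots&\phi_r^{r-1}\end{bmatrix}.$$ Assume that 1. the matrix $\mathbf{A}$ has full rank (along the input-output trajectories of the system), and 2. the map $\boldsymbol\alpha=(\alpha_1,\dots,\alpha_r):\Theta\to\mathbb{R}^r$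 is one-to-one. Then the system is globally identifiable.
   Context: Setting. $X\subseteq\mathbb{R}^{n_x}$, $U\subseteq\mathbb{R}^{n_u}$, $Y\subseteq\mathbb{R}^{n_y}$, $\Theta\subseteq\mathbb{R}^{n_\theta}$ are nonempty discrete sets (each point is at distance larger than some $\delta>0$, possibly depending on the point, from all other points of the set, in Euclidean distance), $\mathbf{f}:X\times U\times\Theta\to X$ and $\mathbf{g}:X\times\Theta\to Y$. For integers $a\le b$, $\langle\mathbf{h}(t)\rangle_a^b$ denotes the finite sequence $(\mathbf{h}(a),\dots,\mathbf{h}(b))$. For $\mathbf{x}_0\in X$, $\mathbf{u}^*\in U^{T}$, $\boldsymbol\theta\in\Theta$, $\langle\mathbf{y}(t,\mathbf{x}_0,\mathbf{u}^*,\boldsymbol\theta)\rangle_0^T\in Y^{T+1}$ is the output sequence generated from initial state $\mathbf{x}_0$, input $\mathbf{u}^*$ and parameter $\boldsymbol\theta$. Full rank of $\mathbf{A}$. The matrix $\mathbf{A}$ is a function of the input sequence $\langle\mathbf{u}(t)\rangle_0^{T+r-2}$ and the output sequence $\langle\mathbf{y}(t)\rangle_0^{T+r-1}$; having full rank means $\det\mathbf{A}\neq0$ whenever $\mathbf{y}$ is the output of the system for some $\boldsymbol\theta\in\Theta$, $\mathbf{x}_0\in X$ and the input $\mathbf{u}$. Global identifiability. The system is globally identifiable at $\boldsymbol\theta\in\Theta$ if there exist an integer $T'>0$ and an input sequence $\mathbf{u}^*\in U^{T'}$ such that for all $\boldsymbol\theta'\in\Theta$ and all $\mathbf{x}_0\in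 X$, $$\boldsymbol\theta\neq\boldsymbol\theta'\ \Rightarrow\ \langle\mathbf{y}(t,\mathbf{x}_0,\mathbf{u}^*,\boldsymbol\theta)\rangle_0^{T'}\neq\langle\mathbf{y}(t,\mathbf{x}_0,\mathbf{u}^*,\boldsymbol\theta')\rangle_0^{T'} .$$ It is globally identifiable if it is globally identifiable at every $\boldsymbol\theta\in\Theta$. *)

theory Defs
  imports
    "HOL-Library.FuncSet"
    "HOL-Analysis.Finite_Cartesian_Product"
    "HOL-Analysis.Isolated"
    "Jordan_Normal_Form.Determinant"
begin

text \<open>
  The library notion \<^const>\<open>discrete\<close> agrees with the metric one: every point of the set has
  distance larger than some positive \<open>\<delta>\<close>, depending on the point, from all other points.
\<close>

lemma discrete_iff_dist:
  fixes S :: "'a::metric_space set"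
  shows "discrete S \<longleftrightarrow> (\<forall>x\<in>S. \<exists>\<delta>>0. \<forall>y\<in>S. y \<noteq> x \<longrightarrow> dist x y > \<delta>)"
proof -
  have "(\<exists>e>0. \<forall>y\<in>S. dist x y < e \<longrightarrow> y = x) \<longleftrightarrow>
        (\<exists>\<delta>>0. \<forall>y\<in>S. y \<noteq> x \<longrightarrow> dist x y > \<delta>)" for x
    by (meson dense less_le_not_le not_less order_less_le_trans)
  then show ?thesis
    by (simp add: discrete_def isolated_in_dist_Ex_iff)
qed

text \<open>
  An input is a function on all of \<^typ>\<open>nat\<close>, but the state and the output at time \<open>t\<close> depend
  only on its values at the times \<open>0, \<dots>, t - 1\<close>.  A finite input sequence over the times
  \<open>a, \<dots>, b\<close> is therefore given by any function in \<open>{a..b} \<rightarrow> U\<close>.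
\<close>

primrec state :: "('x \<Rightarrow> 'u \<Rightarrow> 'p \<Rightarrow> 'x) \<Rightarrow> 'x \<Rightarrow> (nat \<Rightarrow> 'u) \<Rightarrow> 'p \<Rightarrow> nat \<Rightarrow> 'x" where
  "state f x0 u \<theta> 0 = x0"
| "state f x0 u \<theta> (Suc t) = f (state f x0 u \<theta> t) (u t) \<theta>"

definition sys_output ::
  "('x \<Rightarrow> 'u \<Rightarrow> 'p \<Rightarrow> 'x) \<Rightarrow> ('x \<Rightarrow> 'p \<Rightarrow> 'y) \<Rightarrow> 'x \<Rightarrow> (nat \<Rightarrow> 'u) \<Rightarrow> 'p \<Rightarrow> nat \<Rightarrow> 'y" where
  "sys_output f g x0 u \<theta> t = g (state f x0 u \<theta> t) \<theta>"

text \<open>\<open>finseq h a b\<close> is the finite sequence \<open>(h a, \<dots>, h b)\<close>; both end points are included.\<close>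

definition finseq :: "(nat \<Rightarrow> 'a) \<Rightarrow> nat \<Rightarrow> nat \<Rightarrow> 'a list" where
  "finseq h a b = map h [a..<Suc b]"

definition globally_identifiable_at ::
  "'x set \<Rightarrow> 'u set \<Rightarrow> 'p set \<Rightarrow> ('x \<Rightarrow> 'u \<Rightarrow> 'p \<Rightarrow> 'x) \<Rightarrow> ('x \<Rightarrow> 'p \<Rightarrow> 'y) \<Rightarrow> 'p \<Rightarrow> bool" where
  "globally_identifiable_at X U \<Theta> f g \<theta> \<longleftrightarrow>
     (\<exists>T'>0. \<exists>u \<in> {0..T' - 1} \<rightarrow> U. \<forall>\<theta>'\<in>\<Theta>. \<forall>x0\<in>X. \<theta> \<noteq> \<theta>' \<longrightarrow>
        finseq (sys_output f g x0 u \<theta>) 0 T' \<noteq> finseq (sys_output f g x0 u \<theta>') 0 T')"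

definition globally_identifiable ::
  "'x set \<Rightarrow> 'u set \<Rightarrow> 'p set \<Rightarrow> ('x \<Rightarrow> 'u \<Rightarrow> 'p \<Rightarrow> 'x) \<Rightarrow> ('x \<Rightarrow> 'p \<Rightarrow> 'y) \<Rightarrow> bool" where
  "globally_identifiable X U \<Theta> f g \<longleftrightarrow> (\<forall>\<theta>\<in>\<Theta>. globally_identifiable_at X U \<Theta> f g \<theta>)"

text \<open>
  Matrix indices of \<^const>\<open>mat\<close> start at \<open>0\<close>, so column \<open>i\<close> carries \<open>\<phi> (Suc i)\<close>; row \<open>s\<close> uses the
  input and output windows shifted by \<open>s\<close>.
\<close>

definition io_matrix ::
  "(nat \<Rightarrow> 'u list \<Rightarrow> 'y list \<Rightarrow> real) \<Rightarrow> nat \<Rightarrow> nat \<Rightarrow> (nat \<Rightarrow> 'u) \<Rightarrow> (nat \<Rightarrow> 'y) \<Rightarrow> real mat" where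
  "io_matrix \<phi> T r u y =
     mat r r (\<lambda>(s, i). \<phi> (Suc i) (finseq u s (T - 1 + s)) (finseq y s (T + s)))"

end

theory Submission
  imports Defs
begin

text \<open>
  The system is time invariant, so the input-output relation also holds on the shifted windows.
  Its \<open>r\<close> shifts form a linear system with matrix \<open>A\<close> and unknown vector
  \<open>(\<alpha>\<^sub>1, \<dots>, \<alpha>\<^sub>r)\<close>; its coefficients and right-hand side depend only on the inputs and outputs
  up to time \<open>T + r - 1\<close>. Since \<open>A\<close> is nonsingular, these data determine the vector, which in
  turn determines the parameter. Any input sequence of length \<open>T + r - 1\<close> therefore works.
\<close>

text \<open>The state at time \<open>n\<close> is computed from inputs at times before
  \<open>n\<close> only, so an input known to lie in \<open>U\<close> on a finite window
  suffices.\<close>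

lemma state_in:
  assumes "x0 \<in> X" and "u \<in> {..<n} \<rightarrow> U" and "\<theta> \<in> \<Theta>"
    and "\<And>x v \<theta>. x \<in> X \<Longrightarrow> v \<in> U \<Longrightarrow> \<theta> \<in> \<Theta> \<Longrightarrow> f x v \<theta> \<in> X"
  shows "state f x0 u \<theta> n \<in> X"
  using assms(2) by (induction n) (auto simp: assms Pi_iff)

text \<open>\<open>f\<close> does not depend on time, so a trajectory can be restarted at time
  \<open>s\<close> from the state reached there, with the input shifted by \<open>s\<close>.\<close>

lemma state_add:
  "state f x0 u \<theta> (t + s) = state f (state f x0 u \<theta> s) (\<lambda>t. u (t + s)) \<theta> t"
  by (induction t) auto

lemma sys_output_add:
  "sys_output f g x0 u \<theta> (t + s) = sys_output f g (state f x0 u \<theta> s) (\<lambda>t. u (t + s)) \<theta> t"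
  by (simp add: sys_output_def state_add)

lemma finseq_shift: "finseq h (a + s) (b + s) = finseq (\<lambda>t. h (t + s)) a b"
  unfolding finseq_def by (rule nth_equalityI) (simp_all del: upt_Suc add: add.commute add.left_commute)

lemma finseq_eq_iff: "finseq h a b = finseq h' a b \<longleftrightarrow> (\<forall>t\<in>{a..b}. h t = h' t)"
  unfolding finseq_def map_eq_conv by (auto simp del: upt_Suc)

text \<open>Row \<open>s\<close> is the input-output relation for the trajectory restarted at time
  \<open>s\<close>, with the term of index 0 moved to the right-hand side.\<close>

lemma io_matrix_mult_alpha:
  fixes \<phi> :: "nat \<Rightarrow> 'u list \<Rightarrow> 'y list \<Rightarrow> real"
  assumes f_closed: "\<And>x v \<theta>. x \<in> X \<Longrightarrow> v \<in> U \<Longrightarrow> \<theta> \<in> \<Theta> \<Longrightarrow> f x v \<theta> \<in> X"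
    and "T \<ge> 1"
    and alpha_0: "\<alpha> 0 \<theta> = 1"
    and io_relation: "\<And>x0 u. x0 \<in> X \<Longrightarrow> u \<in> {0..T - 1} \<rightarrow> U \<Longrightarrow>
          (\<Sum>i=0..r. \<alpha> i \<theta> * \<phi> i (finseq u 0 (T - 1)) (finseq (sys_output f g x0 u \<theta>) 0 T)) = 0"
    and "\<theta> \<in> \<Theta>" and "x0 \<in> X" and u: "u \<in> {0..T + r - 2} \<rightarrow> U"
  defines "y \<equiv> sys_output f g x0 u \<theta>"
  shows "io_matrix \<phi> T r u y *\<^sub>v Matrix.vec r (\<lambda>i. \<alpha> (Suc i) \<theta>) =
         Matrix.vec r (\<lambda>s. - \<phi> 0 (finseq u s (T - 1 + s)) (finseq y s (T + s)))"
proof (rule eq_vecI)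
  fix s assume "s < dim_vec (Matrix.vec r
      (\<lambda>s. - \<phi> 0 (finseq u s (T - 1 + s)) (finseq y s (T + s))))"
  then have s: "s < r" by simp
  let ?P = "\<lambda>i. \<phi> i (finseq u s (T - 1 + s)) (finseq y s (T + s))"
  \<comment> \<open>The state at time \<open>s\<close> is itself an admissible initial state, so
    \<open>io_relation\<close> can be applied from there.\<close>
  have "state f x0 u \<theta> s \<in> X"
    using u s \<open>T \<ge> 1\<close> \<open>x0 \<in> X\<close> \<open>\<theta> \<in> \<Theta>\<close> by (intro state_in[where U = U and \<Theta> = \<Theta>] f_closed) auto
  \<comment> \<open>The last input read is at time T - 1 + s, which is at most T + r - 2 because s <
    r.\<close>
  moreover have "(\<lambda>t. u (t + s)) \<in> {0..T - 1} \<rightarrow> U"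
    using s \<open>T \<ge> 1\<close> by (auto intro!: funcset_mem[OF u])
  ultimately have "(\<Sum>i=0..r. \<alpha> i \<theta> * ?P i) = 0"
    using io_relation finseq_shift[of u 0 s "T - 1"] finseq_shift[of y 0 s T]
    by (simp add: y_def sys_output_add)
  \<comment> \<open>Split off the term i = 0, whose coefficient is 1, and reindex the others by
    \<open>Suc\<close> to match the columns numbered from 0.\<close>
  then have "(\<Sum>i<r. \<alpha> (Suc i) \<theta> * ?P (Suc i)) = - ?P 0"
    by (simp add: sum.atLeast0_atMost_Suc_shift sum.atMost_shift atLeast0AtMost alpha_0)
  then show "vec_index (io_matrix \<phi> T r u y *\<^sub>v Matrix.vec r (\<lambda>i. \<alpha> (Suc i) \<theta>)) s =
      vec_index (Matrix.vec r (\<lambda>s. - \<phi> 0 (finseq u s (T - 1 + s)) (finseq y s (T + s)))) s"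
    using s by (simp add: io_matrix_def scalar_prod_def atLeast0LessThan mult.commute)
qed (simp add: io_matrix_def)

text \<open>The difference \<open>v - w\<close> lies in the kernel of \<open>A\<close>, which is
  trivial over a field when the determinant is nonzero.\<close>

lemma mult_mat_vec_inj:
  fixes A :: "'a::field mat"
  assumes A: "A \<in> carrier_mat n n" and "det A \<noteq> 0"
    and v: "v \<in> carrier_vec n" and w: "w \<in> carrier_vec n" and eq: "A *\<^sub>v v = A *\<^sub>v w"
  shows "v = w"
proof -
  have "A *\<^sub>v (v - w) = 0\<^sub>v n"
    using A v w eq by (simp add: mult_minus_distrib_mat_vec)
  then have "v - w = 0\<^sub>v n"
    using det_0_iff_vec_prod_zero_field[OF A] \<open>det A \<noteq> 0\<close> minus_carrier_vec[OF v w] by metis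
  show ?thesis
  proof (rule eq_vecI)
    fix i assume "i < dim_vec w"
    then have "(v - w) $ i = 0"
      using \<open>v - w = 0\<^sub>v n\<close> w by simp
    then show "v $ i = w $ i"
      using \<open>i < dim_vec w\<close> by simp
  qed (use v w in auto)
qed

theorem theorem2:
  fixes X :: "(real ^ 'nx) set" and U :: "(real ^ 'nu) set"
    and Y :: "(real ^ 'ny) set" and \<Theta> :: "(real ^ 'np) set"
    and f :: "real ^ 'nx \<Rightarrow> real ^ 'nu \<Rightarrow> real ^ 'np \<Rightarrow> real ^ 'nx"
    and g :: "real ^ 'nx \<Rightarrow> real ^ 'np \<Rightarrow> real ^ 'ny"
    and T r :: nat
    and \<phi> :: "nat \<Rightarrow> (real ^ 'nu) list \<Rightarrow> (real ^ 'ny) list \<Rightarrow> real"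
    and \<alpha> :: "nat \<Rightarrow> real ^ 'np \<Rightarrow> real"
  assumes "X \<noteq> {}" "discrete X"
    and "U \<noteq> {}" "discrete U"
    and "Y \<noteq> {}" "discrete Y"
    and "\<Theta> \<noteq> {}" "discrete \<Theta>"
    and f_closed: "\<And>x v \<theta>. x \<in> X \<Longrightarrow> v \<in> U \<Longrightarrow> \<theta> \<in> \<Theta> \<Longrightarrow> f x v \<theta> \<in> X"
    and g_closed: "\<And>x \<theta>. x \<in> X \<Longrightarrow> \<theta> \<in> \<Theta> \<Longrightarrow> g x \<theta> \<in> Y"
    and "T \<ge> 1" "r \<ge> 1"
    and alpha_0: "\<And>\<theta>. \<theta> \<in> \<Theta> \<Longrightarrow> \<alpha> 0 \<theta> = 1"
    and io_relation: "\<And>\<theta> x0 u. \<theta> \<in> \<Theta> \<Longrightarrow> x0 \<in> X \<Longrightarrow> u \<in> {0..T - 1} \<rightarrow> U \<Longrightarrow>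
          (\<Sum>i=0..r. \<alpha> i \<theta> * \<phi> i (finseq u 0 (T - 1)) (finseq (sys_output f g x0 u \<theta>) 0 T)) = 0"
    and full_rank: "\<And>\<theta> x0 u. \<theta> \<in> \<Theta> \<Longrightarrow> x0 \<in> X \<Longrightarrow> u \<in> {0..T + r - 2} \<rightarrow> U \<Longrightarrow>
          det (io_matrix \<phi> T r u (sys_output f g x0 u \<theta>)) \<noteq> 0"
    and alpha_inj: "inj_on (\<lambda>\<theta>. Matrix.vec r (\<lambda>i. \<alpha> (Suc i) \<theta>)) \<Theta>"
  shows "globally_identifiable X U \<Theta> f g"
proof -
  obtain v where "v \<in> U" using \<open>U \<noteq> {}\<close> by blast
  \<comment> \<open>A constant input lies in \<open>U\<close> at every time, and it is chosen before
    the parameters and the initial state.\<close>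
  define u :: "nat \<Rightarrow> real ^ 'nu" where "u = (\<lambda>_. v)"
  have u: "u \<in> {0..T + r - 2} \<rightarrow> U" using \<open>v \<in> U\<close> by (simp add: u_def)
  have eq: "\<theta> = \<theta>'"
    if "\<theta> \<in> \<Theta>" "\<theta>' \<in> \<Theta>" "x0 \<in> X"
      and out: "finseq (sys_output f g x0 u \<theta>) 0 (T + r - 1) =
                finseq (sys_output f g x0 u \<theta>') 0 (T + r - 1)" for \<theta> \<theta>' x0
  proof -
    let ?y = "sys_output f g x0 u \<theta>" and ?y' = "sys_output f g x0 u \<theta>'"
    let ?A = "io_matrix \<phi> T r u"
    let ?a = "\<lambda>\<theta>. Matrix.vec r (\<lambda>i. \<alpha> (Suc i) \<theta>)"
    let ?b = "\<lambda>y. Matrix.vec r (\<lambda>s. - \<phi> 0 (finseq u s (T - 1 + s)) (finseq y s (T + s)))"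
    have mult_alpha: "?A (sys_output f g x0 u \<theta>) *\<^sub>v ?a \<theta> = ?b (sys_output f g x0 u \<theta>)"
      if "\<theta> \<in> \<Theta>" "x0 \<in> X" for \<theta> x0
    proof (rule io_matrix_mult_alpha[where X = X and U = U and \<Theta> = \<Theta> and \<alpha> = \<alpha>
          and \<phi> = \<phi> and \<theta> = \<theta> and f = f and g = g])
      show "f x v \<theta> \<in> X" if "x \<in> X" "v \<in> U" "\<theta> \<in> \<Theta>" for x v \<theta>
        using that by (rule f_closed)
      show "(\<Sum>i=0..r. \<alpha> i \<theta> * \<phi> i (finseq u 0 (T - 1)) (finseq (sys_output f g x0 u \<theta>) 0 T)) = 0"
        if "x0 \<in> X" "u \<in> {0..T - 1} \<rightarrow> U" for x0 u
        using \<open>\<theta> \<in> \<Theta>\<close> that by (rule io_relation)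
    qed (fact \<open>T \<ge> 1\<close> alpha_0[OF that(1)] that u)+
    \<comment> \<open>The last row, s = r - 1, reads outputs up to T + r - 1; this fixes the horizon
      on which the outputs must agree.\<close>
    have win: "finseq ?y s (T + s) = finseq ?y' s (T + s)" if "s < r" for s
      using out that by (auto simp: finseq_eq_iff)
    have A: "?A ?y = ?A ?y'"
      by (rule eq_matI) (simp_all add: io_matrix_def win)
    have "?A ?y *\<^sub>v ?a \<theta> = ?b ?y"
      by (rule mult_alpha[OF \<open>\<theta> \<in> \<Theta>\<close> \<open>x0 \<in> X\<close>])
    also have "\<dots> = ?b ?y'"
      by (rule eq_vecI) (simp_all add: win)
    also have "\<dots> = ?A ?y' *\<^sub>v ?a \<theta>'"
      by (rule mult_alpha[OF \<open>\<theta>' \<in> \<Theta>\<close> \<open>x0 \<in> X\<close>, symmetric])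
    finally have "?A ?y *\<^sub>v ?a \<theta> = ?A ?y *\<^sub>v ?a \<theta>'"
      by (simp only: A)
    \<comment> \<open>Both coefficient vectors now solve one system, whose matrix is nonsingular by
      \<open>full_rank\<close> along the trajectory of \<open>\<theta>\<close>.\<close>
    then have "?a \<theta> = ?a \<theta>'"
      by (rule mult_mat_vec_inj[of "?A ?y" r, rotated -1])
         (simp_all add: full_rank \<open>\<theta> \<in> \<Theta>\<close> \<open>x0 \<in> X\<close> u, simp add: io_matrix_def)
    then show "\<theta> = \<theta>'"
      by (rule inj_onD[OF alpha_inj _ \<open>\<theta> \<in> \<Theta>\<close> \<open>\<theta>' \<in> \<Theta>\<close>])
  qed
  \<comment> \<open>The witness for \<open>T'\<close> is T + r - 1: its inputs end one step before
    its last output, at T + r - 2.\<close>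
  have pos: "T + r - 1 > 0" and mem: "u \<in> {0..T + r - 1 - 1} \<rightarrow> U"
    using \<open>T \<ge> 1\<close> \<open>v \<in> U\<close> \<open>r \<ge> 1\<close> by (simp_all add: u_def)
  show ?thesis
    unfolding globally_identifiable_def globally_identifiable_at_def
  proof
    fix \<theta> assume "\<theta> \<in> \<Theta>"
    then have "\<forall>\<theta>'\<in>\<Theta>. \<forall>x0\<in>X. \<theta> \<noteq> \<theta>' \<longrightarrow>
        finseq (sys_output f g x0 u \<theta>) 0 (T + r - 1) \<noteq> finseq (sys_output f g x0 u \<theta>') 0 (T + r - 1)"
      using eq by blast
    with pos mem show "\<exists>T'>0. \<exists>u\<in>{0..T' - 1} \<rightarrow> U. \<forall>\<theta>'\<in>\<Theta>. \<forall>x0\<in>X. \<theta> \<noteq> \<theta>' \<longrightarrow>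
        finseq (sys_output f g x0 u \<theta>) 0 T' \<noteq> finseq (sys_output f g x0 u \<theta>') 0 T'"
      by (intro exI[of _ "T + r - 1"] conjI bexI[of _ u])
  qed
qed

end
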